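(* There exists a Banach space $Y$, linearly isomorphic to the binary tree space $X_T$, with a 2-unconditional basis such that the unit ball $B_Y$ is not an SCD set.
   Context: Binary tree space: $T=\{\emptyset\}\cup\bigcup_{n\in\mathbb{N}}\{0,1\}^n$ is the infinite binary tree of finite $0$-$1$ sequences, ordered by $s\preceq t$ iff $s$ is an initial segment of $t$. A chain is a non-empty (totally, hence well) ordered subset of $T$; $\mathcal{A}$ is the collection of all chains. $X_T$ is the real Banach space obtained by completing the space $c_{00}(T)$ of finitely supported real functions on $T$ for the norm $\|x\|=\sup_{A\in\mathcal{A}}\sum_{t\in A}|x(t)|$. A basis $(u_n)$ of a real Banach space is $K$-unconditional if $\|\sum_n\theta_na_nu_n\|\leq K\|\sum_na_nu_n\|$ for all finitely supported real sequences $(a_n)$ and all signs $\theta_n\in\{-1,1\}$. SCD: Let $A$ be a bounded non-empty subset of a real Banach space $X$. A slice of $A$ is a set $S(A,f,\delta)=\{x\in A\colon f(x)>\sup f(A)-\delta\}$ with $f\in X^*$, $\delta>0$. A collection $\{A_i\}_{i\in I}$ of non-empty subsets of $A$ is determining for $A$ if $A\subseteq\overline{\mathrm{conv}}\{x_i\colon i\in I\}$ for every $(x_i)_{i\in I}\in\prod_{i\in I}A_i$. The set $A$ is slicely countably determined (an SCD set) if it admits a countable determining collection of slices. *)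

theory Defs
  imports "HOL-Analysis.Analysis" "HOL-Library.Function_Algebras" "HOL-Library.Sublist"
begin

instantiation "fun" :: (type, real_vector) real_vector
begin

definition scaleR_fun :: "real \<Rightarrow> ('a \<Rightarrow> 'b) \<Rightarrow> 'a \<Rightarrow> 'b"
  where "scaleR_fun r f = (\<lambda>t. r *\<^sub>R f t)"

instance
  by standard (auto simp: scaleR_fun_def plus_fun_def scaleR_add_right scaleR_add_left)

end

lemma scaleR_fun_apply [simp]: "(r *\<^sub>R f) t = r *\<^sub>R f t"
  by (simp add: scaleR_fun_def)


section \<open>Normed spaces given by a carrier and a norm\<close>

text \<open>
  Since one cannot quantify over types inside a formula, a normed space is a pair of a linear
  subspace \<open>V\<close> of some ambient real vector space and a norm \<open>N\<close> on \<open>V\<close>; the ambient space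
  contributes only its linear structure. Values of \<open>N\<close> outside \<open>V\<close> are irrelevant.
\<close>

locale normed_space_on =
  fixes V :: "'a::real_vector set" and N :: "'a \<Rightarrow> real"
  assumes subspace_carrier: "subspace V"
    and norm_ge_0: "x \<in> V \<Longrightarrow> 0 \<le> N x"
    and norm_eq_0_iff: "x \<in> V \<Longrightarrow> N x = 0 \<longleftrightarrow> x = 0"
    and norm_scale: "x \<in> V \<Longrightarrow> N (r *\<^sub>R x) = \<bar>r\<bar> * N x"
    and norm_triangle: "x \<in> V \<Longrightarrow> y \<in> V \<Longrightarrow> N (x + y) \<le> N x + N y"

text \<open>The distance is cut off outside \<open>V\<close> because \<^locale>\<open>Metric_space\<close> wants a function that is
  nonnegative and symmetric on the whole type.\<close>

definition dist_on :: "'a::real_vector set \<Rightarrow> ('a \<Rightarrow> real) \<Rightarrow> 'a \<Rightarrow> 'a \<Rightarrow> real"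
  where "dist_on V N x y = (if x \<in> V \<and> y \<in> V then N (x - y) else 0)"

abbreviation norm_topology :: "'a::real_vector set \<Rightarrow> ('a \<Rightarrow> real) \<Rightarrow> 'a topology"
  where "norm_topology V N \<equiv> Metric_space.mtopology V (dist_on V N)"

sublocale normed_space_on \<subseteq> Metric_space V "dist_on V N"
proof
  fix x y z
  show "0 \<le> dist_on V N x y"
    using norm_ge_0 subspace_diff[OF subspace_carrier] by (auto simp: dist_on_def)
  show "dist_on V N x y = dist_on V N y x"
    using norm_scale[of "x - y" "-1"] subspace_diff[OF subspace_carrier] by (auto simp: dist_on_def)
  show "dist_on V N x y = 0 \<longleftrightarrow> x = y" if "x \<in> V" "y \<in> V"
    using norm_eq_0_iff[of "x - y"] subspace_diff[OF subspace_carrier] that by (auto simp: dist_on_def)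
  show "dist_on V N x z \<le> dist_on V N x y + dist_on V N y z"
    if "x \<in> V" "y \<in> V" "z \<in> V"
    using norm_triangle[of "x - y" "y - z"] subspace_diff[OF subspace_carrier] that
    by (auto simp: dist_on_def)
qed

locale banach_space_on = normed_space_on +
  assumes complete: mcomplete

definition bounded_linear_on ::
  "'a::real_vector set \<Rightarrow> ('a \<Rightarrow> real) \<Rightarrow> 'b::real_vector set \<Rightarrow> ('b \<Rightarrow> real) \<Rightarrow> ('a \<Rightarrow> 'b) \<Rightarrow> bool"
  where "bounded_linear_on V N W M f \<longleftrightarrow>
    f ` V \<subseteq> W \<and>
    (\<forall>x\<in>V. \<forall>y\<in>V. f (x + y) = f x + f y) \<and>
    (\<forall>r. \<forall>x\<in>V. f (r *\<^sub>R x) = r *\<^sub>R f x) \<and>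
    (\<exists>C. \<forall>x\<in>V. M (f x) \<le> C * N x)"

definition linearly_isomorphic ::
  "'a::real_vector set \<Rightarrow> ('a \<Rightarrow> real) \<Rightarrow> 'b::real_vector set \<Rightarrow> ('b \<Rightarrow> real) \<Rightarrow> bool"
  where "linearly_isomorphic V N W M \<longleftrightarrow>
    (\<exists>f g. bounded_linear_on V N W M f \<and> bounded_linear_on W M V N g \<and>
      (\<forall>x\<in>V. g (f x) = x) \<and> (\<forall>y\<in>W. f (g y) = y))"

definition dual_on :: "'a::real_vector set \<Rightarrow> ('a \<Rightarrow> real) \<Rightarrow> ('a \<Rightarrow> real) set"
  where "dual_on V N = {f. bounded_linear_on V N UNIV abs f}"

definition unit_ball :: "'a::real_vector set \<Rightarrow> ('a \<Rightarrow> real) \<Rightarrow> 'a set"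
  where "unit_ball V N = {x\<in>V. N x \<le> 1}"


section \<open>Unconditional bases\<close>

definition schauder_basis ::
  "'a::real_vector set \<Rightarrow> ('a \<Rightarrow> real) \<Rightarrow> (nat \<Rightarrow> 'a) \<Rightarrow> bool"
  where "schauder_basis V N u \<longleftrightarrow>
    range u \<subseteq> V \<and>
    (\<forall>x\<in>V. \<exists>!a. limitin (norm_topology V N) (\<lambda>n. \<Sum>k<n. a k *\<^sub>R u k) x sequentially)"

definition unconditional_basis ::
  "real \<Rightarrow> 'a::real_vector set \<Rightarrow> ('a \<Rightarrow> real) \<Rightarrow> (nat \<Rightarrow> 'a) \<Rightarrow> bool"
  where "unconditional_basis K V N u \<longleftrightarrow>
    schauder_basis V N u \<and>
    (\<forall>a \<theta>. finite {n. a n \<noteq> 0} \<and> range \<theta> \<subseteq> {-1, 1} \<longrightarrow>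
      N (\<Sum>n | a n \<noteq> 0. (\<theta> n * a n) *\<^sub>R u n) \<le> K * N (\<Sum>n | a n \<noteq> 0. a n *\<^sub>R u n))"


section \<open>Slicely countably determined sets\<close>

definition slice :: "'a set \<Rightarrow> ('a \<Rightarrow> real) \<Rightarrow> real \<Rightarrow> 'a set"
  where "slice A f \<delta> = {x\<in>A. f x > (SUP y\<in>A. f y) - \<delta>}"

definition determining ::
  "'a::real_vector set \<Rightarrow> ('a \<Rightarrow> real) \<Rightarrow> 'a set \<Rightarrow> 'i set \<Rightarrow> ('i \<Rightarrow> 'a set) \<Rightarrow> bool"
  where "determining V N A I S \<longleftrightarrow>
    (\<forall>i\<in>I. S i \<noteq> {} \<and> S i \<subseteq> A) \<and>
    (\<forall>x\<in>Pi I S. A \<subseteq> norm_topology V N closure_of (convex hull (x ` I)))"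

text \<open>Only meaningful for bounded non-empty \<open>A \<subseteq> V\<close>. Countable families are indexed by
  sets of natural numbers.\<close>

definition SCD :: "'a::real_vector set \<Rightarrow> ('a \<Rightarrow> real) \<Rightarrow> 'a set \<Rightarrow> bool"
  where "SCD V N A \<longleftrightarrow>
    (\<exists>(I :: nat set) S.
      (\<forall>i\<in>I. \<exists>f\<in>dual_on V N. \<exists>\<delta>>0. S i = slice A f \<delta>) \<and> determining V N A I S)"


section \<open>The binary tree space\<close>

text \<open>The tree is \<^typ>\<open>bool list\<close>, ordered by \<^const>\<open>prefix\<close>.\<close>

definition tree_chains :: "bool list set set"
  where "tree_chains = {A. A \<noteq> {} \<and> (\<forall>s\<in>A. \<forall>t\<in>A. prefix s t \<or> prefix t s)}"

definition c00 :: "(bool list \<Rightarrow> real) set"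
  where "c00 = {x. finite {t. x t \<noteq> 0}}"

text \<open>
  The completion of \<^term>\<open>c00\<close> is realised inside the space of all functions on the tree,
  as the closure of \<^term>\<open>c00\<close> for the same norm formula, read with values in \<open>[0, \<infinity>]\<close>.
  That this is the completion is proved below (\<open>tree_norm_c00\<close>, \<open>c00_subset_X_T\<close>,
  \<open>banach_X_T\<close>, \<open>c00_dense\<close>).
\<close>

definition tree_enorm :: "(bool list \<Rightarrow> real) \<Rightarrow> ennreal"
  where "tree_enorm x = (SUP A\<in>tree_chains. \<Sum>\<^sub>\<infinity>t\<in>A. ennreal \<bar>x t\<bar>)"

definition tree_norm :: "(bool list \<Rightarrow> real) \<Rightarrow> real"
  where "tree_norm x = enn2real (tree_enorm x)"

definition X_T :: "(bool list \<Rightarrow> real) set"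
  where "X_T = {x. \<forall>\<epsilon>>0. \<exists>y\<in>c00. tree_enorm (x - y) < ennreal \<epsilon>}"

lemma tree_enorm_le_iff:
  assumes "0 \<le> c"
  shows "tree_enorm x \<le> ennreal c \<longleftrightarrow>
    (\<forall>A\<in>tree_chains. \<forall>F. finite F \<and> F \<subseteq> A \<longrightarrow> (\<Sum>t\<in>F. \<bar>x t\<bar>) \<le> c)"
proof -
  have "(\<Sum>\<^sub>\<infinity>t\<in>A. ennreal \<bar>x t\<bar>) = (SUP F\<in>{F. finite F \<and> F \<subseteq> A}. ennreal (\<Sum>t\<in>F. \<bar>x t\<bar>))" for A
    by (subst nonneg_infsum_complete) auto
  then show ?thesis
    using assms by (auto simp: tree_enorm_def SUP_le_iff ennreal_le_iff)
qed

lemma tree_enorm_triangle: "tree_enorm (x + y) \<le> tree_enorm x + tree_enorm y"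
proof (cases "tree_enorm x = top \<or> tree_enorm y = top")
  case False
  then obtain a b where ab: "tree_enorm x = ennreal a" "0 \<le> a" "tree_enorm y = ennreal b" "0 \<le> b"
    by (metis ennreal_cases)
  have "(\<Sum>t\<in>F. \<bar>(x + y) t\<bar>) \<le> a + b" if "A \<in> tree_chains" "finite F" "F \<subseteq> A" for A F
  proof -
    have "(\<Sum>t\<in>F. \<bar>(x + y) t\<bar>) \<le> (\<Sum>t\<in>F. \<bar>x t\<bar>) + (\<Sum>t\<in>F. \<bar>y t\<bar>)"
      by (simp add: sum.distrib[symmetric] sum_mono)
    also have "\<dots> \<le> a + b"
      using tree_enorm_le_iff[of a x] tree_enorm_le_iff[of b y] ab that
      by (intro add_mono) auto
    finally show ?thesis .
  qed
  then have "tree_enorm (x + y) \<le> ennreal (a + b)"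
    using ab by (subst tree_enorm_le_iff) auto
  then show ?thesis
    using ab by simp
qed auto

lemma tree_enorm_scale_le: "tree_enorm (r *\<^sub>R x) \<le> ennreal \<bar>r\<bar> * tree_enorm x"
proof (cases "r = 0")
  case True
  then show ?thesis
    using tree_enorm_le_iff[of 0 "0 *\<^sub>R x"] by auto
next
  case r: False
  show ?thesis
  proof (cases "tree_enorm x = top")
    case False
    then obtain a where a: "tree_enorm x = ennreal a" "0 \<le> a"
      by (metis ennreal_cases)
    have "(\<Sum>t\<in>F. \<bar>(r *\<^sub>R x) t\<bar>) \<le> \<bar>r\<bar> * a" if "A \<in> tree_chains" "finite F" "F \<subseteq> A" for A F
    proof -
      have "(\<Sum>t\<in>F. \<bar>(r *\<^sub>R x) t\<bar>) = \<bar>r\<bar> * (\<Sum>t\<in>F. \<bar>x t\<bar>)"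
        by (simp add: abs_mult sum_distrib_left)
      also have "\<dots> \<le> \<bar>r\<bar> * a"
        using tree_enorm_le_iff[of a x] a that by (intro mult_left_mono) auto
      finally show ?thesis .
    qed
    then have "tree_enorm (r *\<^sub>R x) \<le> ennreal (\<bar>r\<bar> * a)"
      using a by (subst tree_enorm_le_iff) auto
    then show ?thesis
      using a by (simp add: ennreal_mult)
  qed (use r in \<open>simp add: ennreal_mult_top\<close>)
qed

lemma tree_enorm_uminus: "tree_enorm (- x) = tree_enorm x"
  by (simp add: tree_enorm_def)

lemma tree_enorm_minus_commute: "tree_enorm (x - y) = tree_enorm (y - x)"
  using tree_enorm_uminus[of "x - y"] by simp

lemma tree_enorm_diff_triangle: "tree_enorm (x - z) \<le> tree_enorm (x - y) + tree_enorm (y - z)"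
  using tree_enorm_triangle[of "x - y" "y - z"] by simp

lemma tree_enorm_c00:
  assumes "x \<in> c00"
  shows "tree_enorm x < top"
proof -
  have fin: "finite {t. x t \<noteq> 0}"
    using assms by (simp add: c00_def)
  have "(\<Sum>t\<in>F. \<bar>x t\<bar>) \<le> (\<Sum>t | x t \<noteq> 0. \<bar>x t\<bar>)" if "finite F" for F
  proof -
    have "(\<Sum>t\<in>F. \<bar>x t\<bar>) = (\<Sum>t\<in>F \<inter> {t. x t \<noteq> 0}. \<bar>x t\<bar>)"
      using that by (intro sum.mono_neutral_right) auto
    also have "\<dots> \<le> (\<Sum>t | x t \<noteq> 0. \<bar>x t\<bar>)"
      using fin by (intro sum_mono2) auto
    finally show ?thesis .
  qed
  then have "tree_enorm x \<le> ennreal (\<Sum>t | x t \<noteq> 0. \<bar>x t\<bar>)"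
    by (subst tree_enorm_le_iff) (auto intro: sum_nonneg)
  then show ?thesis
    using ennreal_less_top le_less_trans by blast
qed

theorem c00_subset_X_T: "c00 \<subseteq> X_T"
proof -
  have "tree_enorm 0 = 0"
    using tree_enorm_le_iff[of 0 0] by simp
  then show ?thesis
    by (auto simp: X_T_def ennreal_less_zero_iff intro!: bexI)
qed

theorem tree_norm_c00:
  assumes "x \<in> c00"
  shows "tree_norm x = (SUP A\<in>tree_chains. \<Sum>t | t \<in> A \<and> x t \<noteq> 0. \<bar>x t\<bar>)"
proof -
  have fin: "finite {t. x t \<noteq> 0}"
    using assms by (simp add: c00_def)
  have eq: "(\<Sum>\<^sub>\<infinity>t\<in>A. ennreal \<bar>x t\<bar>) = ennreal (\<Sum>t | t \<in> A \<and> x t \<noteq> 0. \<bar>x t\<bar>)" for A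
  proof -
    have "(\<Sum>\<^sub>\<infinity>t\<in>A. ennreal \<bar>x t\<bar>) = (\<Sum>\<^sub>\<infinity>t\<in>{t. t \<in> A \<and> x t \<noteq> 0}. ennreal \<bar>x t\<bar>)"
      by (intro infsum_cong_neutral) auto
    also have "\<dots> = (\<Sum>t | t \<in> A \<and> x t \<noteq> 0. ennreal \<bar>x t\<bar>)"
      using fin by (intro infsum_finite) (auto elim: rev_finite_subset)
    finally show ?thesis by simp
  qed
  have ne: "tree_chains \<noteq> {}"
    by (auto simp: tree_chains_def)
  have bdd: "bdd_above ((\<lambda>A. \<Sum>t | t \<in> A \<and> x t \<noteq> 0. \<bar>x t\<bar>) ` tree_chains)"
    using fin by (intro bdd_aboveI2[where M = "\<Sum>t | x t \<noteq> 0. \<bar>x t\<bar>"] sum_mono2) auto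
  obtain a where a: "tree_enorm x = ennreal a" "0 \<le> a"
    using tree_enorm_c00[OF assms] by (metis ennreal_cases less_irrefl)
  show ?thesis
  proof (rule antisym)
    have "tree_enorm x \<le> ennreal (SUP A\<in>tree_chains. \<Sum>t | t \<in> A \<and> x t \<noteq> 0. \<bar>x t\<bar>)"
      unfolding tree_enorm_def eq by (intro SUP_least ennreal_leI cSUP_upper bdd)
    moreover have "0 \<le> (SUP A\<in>tree_chains. \<Sum>t | t \<in> A \<and> x t \<noteq> 0. \<bar>x t\<bar>)"
      using ne bdd by (metis (no_types, lifting) abs_ge_zero cSUP_upper2 ex_in_conv sum_nonneg)
    ultimately show "tree_norm x \<le> (SUP A\<in>tree_chains. \<Sum>t | t \<in> A \<and> x t \<noteq> 0. \<bar>x t\<bar>)"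
      using a by (simp add: tree_norm_def ennreal_le_iff)
  next
    have "ennreal (\<Sum>t | t \<in> A \<and> x t \<noteq> 0. \<bar>x t\<bar>) \<le> ennreal a" if "A \<in> tree_chains" for A
      using that unfolding a(1)[symmetric] tree_enorm_def eq by (rule SUP_upper)
    then show "(SUP A\<in>tree_chains. \<Sum>t | t \<in> A \<and> x t \<noteq> 0. \<bar>x t\<bar>) \<le> tree_norm x"
      using ne a by (intro cSUP_least) (auto simp: tree_norm_def ennreal_le_iff)
  qed
qed

lemma c00_add: "x \<in> c00 \<Longrightarrow> y \<in> c00 \<Longrightarrow> x + y \<in> c00"
  unfolding c00_def
  by (auto intro: rev_finite_subset[of "{t. x t \<noteq> 0} \<union> {t. y t \<noteq> 0}"])

lemma c00_scale: "x \<in> c00 \<Longrightarrow> r *\<^sub>R x \<in> c00"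
  unfolding c00_def by (auto elim!: rev_finite_subset)

lemma tree_enorm_X_T:
  assumes "x \<in> X_T"
  shows "tree_enorm x = ennreal (tree_norm x)"
proof -
  obtain y where y: "y \<in> c00" "tree_enorm (x - y) < ennreal 1"
    using assms by (auto simp: X_T_def dest: spec[of _ 1])
  have "tree_enorm x \<le> tree_enorm (x - y) + tree_enorm y"
    using tree_enorm_triangle[of "x - y" y] by simp
  also have "\<dots> < top"
    using y tree_enorm_c00[of y] by (simp add: less_top[symmetric]) (use top.extremum_strict in fastforce)
  finally show ?thesis
    by (simp add: tree_norm_def)
qed

lemma tree_norm_nonneg: "0 \<le> tree_norm x"
  by (simp add: tree_norm_def)

lemma tree_norm_le_iff:
  assumes "x \<in> X_T" "0 \<le> c"
  shows "tree_norm x \<le> c \<longleftrightarrow>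
    (\<forall>A\<in>tree_chains. \<forall>F. finite F \<and> F \<subseteq> A \<longrightarrow> (\<Sum>t\<in>F. \<bar>x t\<bar>) \<le> c)"
  using tree_enorm_le_iff[OF assms(2), of x] tree_enorm_X_T[OF assms(1)] assms(2)
  by (simp add: ennreal_le_iff)

lemma abs_le_tree_norm:
  assumes "x \<in> X_T"
  shows "\<bar>x t\<bar> \<le> tree_norm x"
proof -
  have "{t} \<in> tree_chains"
    by (simp add: tree_chains_def)
  then have "(\<Sum>t\<in>{t}. \<bar>x t\<bar>) \<le> tree_norm x"
    using iffD1[OF tree_norm_le_iff[OF assms tree_norm_nonneg] order_refl, rule_format,
        of "{t}" "{t}"] by simp
  then show ?thesis by simp
qed

lemma subspace_X_T: "subspace X_T"
proof (rule subspaceI)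
  show "0 \<in> X_T"
    using c00_subset_X_T by (auto simp: c00_def)
next
  fix x y assume xy: "x \<in> X_T" "y \<in> X_T"
  show "x + y \<in> X_T"
    unfolding X_T_def
  proof (intro CollectI allI impI)
    fix \<epsilon> :: real assume "\<epsilon> > 0"
    then have e: "\<epsilon> / 2 > 0" by simp
    then obtain x' y' where *: "x' \<in> c00" "tree_enorm (x - x') < ennreal (\<epsilon> / 2)"
      "y' \<in> c00" "tree_enorm (y - y') < ennreal (\<epsilon> / 2)"
      using xy unfolding X_T_def by blast
    have "tree_enorm (x + y - (x' + y')) \<le> tree_enorm (x - x') + tree_enorm (y - y')"
      using tree_enorm_triangle[of "x - x'" "y - y'"] by (simp add: algebra_simps)
    also have "\<dots> < ennreal (\<epsilon> / 2) + ennreal (\<epsilon> / 2)"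
      using * by (intro add_strict_mono)
    also have "\<dots> = ennreal \<epsilon>"
      using e by (simp add: ennreal_plus[symmetric] del: ennreal_plus)
    finally show "\<exists>z\<in>c00. tree_enorm (x + y - z) < ennreal \<epsilon>"
      using c00_add * by blast
  qed
next
  fix r :: real and x assume x: "x \<in> X_T"
  show "r *\<^sub>R x \<in> X_T"
    unfolding X_T_def
  proof (intro CollectI allI impI)
    fix \<epsilon> :: real assume e: "\<epsilon> > 0"
    then have "\<epsilon> / (\<bar>r\<bar> + 1) > 0" by simp
    then obtain y where y: "y \<in> c00" "tree_enorm (x - y) < ennreal (\<epsilon> / (\<bar>r\<bar> + 1))"
      using x unfolding X_T_def by blast
    have "tree_enorm (r *\<^sub>R x - r *\<^sub>R y) \<le> ennreal \<bar>r\<bar> * tree_enorm (x - y)"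
      using tree_enorm_scale_le[of r "x - y"] by (simp add: scaleR_diff_right)
    also have "\<dots> \<le> ennreal \<bar>r\<bar> * ennreal (\<epsilon> / (\<bar>r\<bar> + 1))"
      using y by (intro mult_left_mono) auto
    also have "\<dots> = ennreal (\<bar>r\<bar> * (\<epsilon> / (\<bar>r\<bar> + 1)))"
      using e by (subst ennreal_mult) auto
    also have "\<dots> < ennreal \<epsilon>"
      using e by (intro ennreal_lessI) (auto simp: field_simps)
    finally show "\<exists>z\<in>c00. tree_enorm (r *\<^sub>R x - z) < ennreal \<epsilon>"
      using y c00_scale by blast
  qed
qed

interpretation X_T: normed_space_on X_T tree_norm
proof
  show "subspace X_T" by (rule subspace_X_T)
next
  fix x y assume x: "x \<in> X_T"
  show "0 \<le> tree_norm x" by (rule tree_norm_nonneg)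
  show "tree_norm x = 0 \<longleftrightarrow> x = 0"
  proof
    assume "tree_norm x = 0"
    then show "x = 0"
      using abs_le_tree_norm[OF x] by (auto simp: fun_eq_iff)
  next
    assume "x = 0"
    then show "tree_norm x = 0"
      using tree_norm_le_iff[OF x, of 0] tree_norm_nonneg[of x] by simp
  qed
  have le: "tree_norm (r *\<^sub>R x) \<le> \<bar>r\<bar> * tree_norm x" if "x \<in> X_T" for r x
    using tree_enorm_scale_le[of r x] subspace_scale[OF subspace_X_T that, of r] that
    by (simp add: tree_enorm_X_T ennreal_mult[symmetric] tree_norm_nonneg ennreal_le_iff)
  show "tree_norm (r *\<^sub>R x) = \<bar>r\<bar> * tree_norm x" for r
  proof (cases "r = 0")
    case True
    then show ?thesis
      using le[OF x, of 0] tree_norm_nonneg[of "0 *\<^sub>R x"] by simp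
  next
    case False
    have "tree_norm x \<le> \<bar>inverse r\<bar> * tree_norm (r *\<^sub>R x)"
      using le[OF subspace_scale[OF subspace_X_T x, of r], of "inverse r"] False by simp
    then have "\<bar>r\<bar> * tree_norm x \<le> tree_norm (r *\<^sub>R x)"
      using False by (simp add: field_simps)
    then show ?thesis
      using le[OF x, of r] by simp
  qed
  assume y: "y \<in> X_T"
  show "tree_norm (x + y) \<le> tree_norm x + tree_norm y"
    using tree_enorm_triangle[of x y] subspace_add[OF subspace_X_T x y] x y
    by (simp add: tree_enorm_X_T ennreal_plus[symmetric] tree_norm_nonneg ennreal_le_iff
        del: ennreal_plus)
qed

theorem banach_X_T: "banach_space_on X_T tree_norm"
proof
  show X_T.mcomplete
    unfolding X_T.mcomplete_def
  proof (intro allI impI)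
    fix \<sigma> assume "X_T.MCauchy \<sigma>"
    then have mem: "\<sigma> n \<in> X_T" for n
      by (auto simp: X_T.MCauchy_def)
    have C: "\<exists>M. \<forall>n\<ge>M. \<forall>m\<ge>M. tree_norm (\<sigma> n - \<sigma> m) < \<epsilon>" if "\<epsilon> > 0" for \<epsilon>
      using \<open>X_T.MCauchy \<sigma>\<close> mem that by (auto simp: X_T.MCauchy_def dist_on_def)
    have diff: "\<sigma> n - \<sigma> m \<in> X_T" for n m
      using mem subspace_diff[OF subspace_X_T] by blast
    have "Cauchy (\<lambda>n. \<sigma> n t)" for t
    proof (rule metric_CauchyI)
      fix \<epsilon> :: real assume "\<epsilon> > 0"
      then obtain M where M: "\<forall>n\<ge>M. \<forall>m\<ge>M. tree_norm (\<sigma> n - \<sigma> m) < \<epsilon>"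
        using C by blast
      have "dist (\<sigma> m t) (\<sigma> n t) < \<epsilon>" if "m \<ge> M" "n \<ge> M" for m n
      proof -
        have "tree_norm (\<sigma> m - \<sigma> n) < \<epsilon>"
          using M that by blast
        then show ?thesis
          using abs_le_tree_norm[OF diff, of m n t] by (simp add: dist_real_def)
      qed
      then show "\<exists>M. \<forall>m\<ge>M. \<forall>n\<ge>M. dist (\<sigma> m t) (\<sigma> n t) < \<epsilon>" by blast
    qed
    then have "\<forall>t. \<exists>l. (\<lambda>n. \<sigma> n t) \<longlonglongrightarrow> l"
      unfolding Cauchy_convergent_iff convergent_def by blast
    from choice[OF this] obtain x where x: "\<And>t. (\<lambda>n. \<sigma> n t) \<longlonglongrightarrow> x t"
      by blast
    have E: "\<exists>M. \<forall>n\<ge>M. tree_enorm (\<sigma> n - x) \<le> ennreal \<epsilon>" if e: "\<epsilon> > 0" for \<epsilon>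
    proof -
      obtain M where M: "\<forall>n\<ge>M. \<forall>m\<ge>M. tree_norm (\<sigma> n - \<sigma> m) < \<epsilon>"
        using C[OF e] by blast
      have "(\<Sum>t\<in>F. \<bar>(\<sigma> n - x) t\<bar>) \<le> \<epsilon>"
        if "n \<ge> M" "A \<in> tree_chains" "finite F" "F \<subseteq> A" for n A F
      proof (rule LIMSEQ_le_const2)
        show "(\<lambda>m. \<Sum>t\<in>F. \<bar>(\<sigma> n - \<sigma> m) t\<bar>) \<longlonglongrightarrow> (\<Sum>t\<in>F. \<bar>(\<sigma> n - x) t\<bar>)"
          unfolding fun_diff_def by (intro tendsto_intros x)
        have "(\<Sum>t\<in>F. \<bar>(\<sigma> n - \<sigma> m) t\<bar>) \<le> \<epsilon>" if "m \<ge> M" for m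
        proof -
          have "tree_norm (\<sigma> n - \<sigma> m) \<le> \<epsilon>"
            using M that \<open>n \<ge> M\<close> by (simp add: less_imp_le)
          then show ?thesis
            using tree_norm_le_iff[OF diff less_imp_le[OF \<open>\<epsilon> > 0\<close>]]
              \<open>A \<in> tree_chains\<close> \<open>finite F\<close> \<open>F \<subseteq> A\<close> by blast
        qed
        then show "\<exists>N. \<forall>m\<ge>N. (\<Sum>t\<in>F. \<bar>(\<sigma> n - \<sigma> m) t\<bar>) \<le> \<epsilon>" by blast
      qed
      then have "\<forall>n\<ge>M. tree_enorm (\<sigma> n - x) \<le> ennreal \<epsilon>"
        using e by (auto simp: tree_enorm_le_iff)
      then show ?thesis by blast
    qed
    have xX: "x \<in> X_T"
      unfolding X_T_def
    proof (intro CollectI allI impI)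
      fix \<epsilon> :: real assume "\<epsilon> > 0"
      then have e: "\<epsilon> / 2 > 0" by simp
      then obtain n where n: "tree_enorm (\<sigma> n - x) \<le> ennreal (\<epsilon> / 2)"
        using E by blast
      obtain y where y: "y \<in> c00" "tree_enorm (\<sigma> n - y) < ennreal (\<epsilon> / 2)"
        using mem[of n] e unfolding X_T_def by blast
      have "tree_enorm (x - y) \<le> tree_enorm (\<sigma> n - x) + tree_enorm (\<sigma> n - y)"
        using tree_enorm_diff_triangle[of x y "\<sigma> n"] by (simp add: tree_enorm_minus_commute)
      also have "\<dots> < ennreal (\<epsilon> / 2) + ennreal (\<epsilon> / 2)"
        using n y by (intro ennreal_add_left_cancel_less[THEN iffD2] order.strict_trans1[OF add_right_mono[OF n]]) auto
      also have "\<dots> = ennreal \<epsilon>"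
        using e by (simp add: ennreal_plus[symmetric] del: ennreal_plus)
      finally show "\<exists>y\<in>c00. tree_enorm (x - y) < ennreal \<epsilon>"
        using y by blast
    qed
    have "limitin X_T.mtopology \<sigma> x sequentially"
      unfolding X_T.limitin_metric
    proof (intro conjI allI impI)
      show "x \<in> X_T" by (rule xX)
      fix \<epsilon> :: real assume e: "\<epsilon> > 0"
      then obtain M where M: "\<forall>n\<ge>M. tree_enorm (\<sigma> n - x) \<le> ennreal (\<epsilon> / 2)"
        using E[of "\<epsilon> / 2"] by auto
      have "tree_norm (\<sigma> n - x) < \<epsilon>" if "n \<ge> M" for n
      proof -
        have "ennreal (tree_norm (\<sigma> n - x)) \<le> ennreal (\<epsilon> / 2)"
          using M[rule_format, OF that]
          unfolding tree_enorm_X_T[OF subspace_diff[OF subspace_X_T mem[of n] xX]] .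
        then show ?thesis using e by (simp add: ennreal_le_iff)
      qed
      then show "\<forall>\<^sub>F n in sequentially. \<sigma> n \<in> X_T \<and> dist_on X_T tree_norm (\<sigma> n) x < \<epsilon>"
        using mem xX by (auto simp: eventually_sequentially dist_on_def)
    qed
    then show "\<exists>x. limitin X_T.mtopology \<sigma> x sequentially" by blast
  qed
qed

theorem c00_dense: "norm_topology X_T tree_norm closure_of c00 = X_T"
proof -
  have "\<exists>y\<in>c00. y \<in> X_T \<and> tree_norm (x - y) < \<epsilon>" if x: "x \<in> X_T" and e: "\<epsilon> > 0" for x and \<epsilon> :: real
  proof -
    obtain y where y: "y \<in> c00" "tree_enorm (x - y) < ennreal \<epsilon>"
      using x e unfolding X_T_def by blast
    then have yX: "y \<in> X_T" using c00_subset_X_T by blast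
    show ?thesis
      using y yX tree_enorm_X_T[OF subspace_diff[OF subspace_X_T x yX]] tree_norm_nonneg
      by (auto simp: ennreal_less_iff)
  qed
  then show ?thesis
    by (fastforce simp: X_T.metric_closure_of dist_on_def)
qed

end

theory Submission
  imports Defs
begin

text \<open>
  The space \<open>Y\<close> is \<^term>\<open>X_T\<close> with the norm \<open>N x = sup \<bar>\<Sum>t\<in>F. x t\<bar>\<close>, where \<open>F\<close> runs over the finite
  totally ordered subsets of the tree. Summing the positive and the negative entries on a chain
  separately gives \<open>N \<le> tree_norm \<le> 2 * N\<close>, and the tree norm does not see signs. Hence \<open>N\<close> is an
  equivalent norm for which the unit vectors form a 2-unconditional basis.

  Cancellation between entries of opposite sign is what destroys the SCD property. Let \<open>x\<close> have
  finite support, let \<open>b\<close> be a branch, and let \<open>t\<close> be a node of \<open>b\<close> longer than all nodes of the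
  support. Let \<open>c\<close> be the sum of \<open>x\<close> over \<open>b\<close>. Then \<open>x - c e\<^sub>t\<close> has sum \<open>0\<close> over \<open>b\<close>, and
  \<open>N (x - c e\<^sub>t) \<le> N x\<close>: a chain through \<open>t\<close> meets the support only in nodes of \<open>b\<close>, so the sum of
  \<open>x - c e\<^sub>t\<close> over it is minus the sum of \<open>x\<close> over the nodes of \<open>b\<close> that the chain misses, and those
  nodes again form a chain (lemma \<open>chain_sum_norm_node_shift\<close>).

  The shift changes the value of a functional \<open>f\<close> at \<open>x\<close> by \<open>c f(e\<^sub>t)\<close>. For each \<open>\<epsilon> > 0\<close> only finitely
  many branches have \<open>\<bar>f(e\<^sub>t)\<bar> \<ge> \<epsilon>\<close> at all their far nodes, because nodes of equal length on
  distinct branches are incomparable, so that signed sums of their unit vectors stay in the unit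
  ball. As there are uncountably many branches, countably many functionals have a common branch
  \<open>b\<close> along which each of them takes arbitrarily small values at far nodes (lemma
  \<open>common_good_branch\<close>). Given countably many slices of the unit ball, one can therefore pick from
  each a point whose sum over \<open>b\<close> is \<open>0\<close>. The same holds for all convex combinations of these
  points, and since the sum over \<open>b\<close> is a functional of norm at most \<open>1\<close>, they all have distance
  at least \<open>1\<close> from the unit vector of the root, whose sum over \<open>b\<close> is \<open>1\<close>. So no countable
  family of slices is determining.
\<close>


section \<open>Countability and equivalent norms\<close>

lemma sum_fun_apply: "(\<Sum>i\<in>I. f i) t = (\<Sum>i\<in>I. f i t)"
  for f :: "'i \<Rightarrow> 'a \<Rightarrow> 'b::comm_monoid_add"
  by (induction I rule: infinite_finite_induct) auto

lemma uncountable_bool_sequences: "uncountable (UNIV :: (nat \<Rightarrow> bool) set)"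
proof
  assume c: "countable (UNIV :: (nat \<Rightarrow> bool) set)"
  define g :: "nat \<Rightarrow> nat \<Rightarrow> bool" where "g = from_nat_into UNIV"
  have "range g = UNIV"
    using c unfolding g_def by (intro range_from_nat_into) auto
  then obtain k where "(\<lambda>n. \<not> g n n) = g k"
    by (metis UNIV_I imageE)
  then show False
    by (metis (full_types))
qed

lemma (in normed_space_on) dist_on_eq: "x \<in> V \<Longrightarrow> y \<in> V \<Longrightarrow> dist_on V N x y = N (x - y)"
  by (simp add: dist_on_def)

lemma (in normed_space_on) limitin_iff_norm:
  assumes "\<And>n. \<sigma> n \<in> V" "x \<in> V"
  shows "limitin mtopology \<sigma> x sequentially \<longleftrightarrow> (\<forall>\<epsilon>>0. \<exists>n0. \<forall>n\<ge>n0. N (\<sigma> n - x) < \<epsilon>)"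
  using assms by (auto simp: limitin_metric eventually_sequentially dist_on_eq)

lemma banach_space_on_equivalent_norm:
  assumes M: "banach_space_on V M" and N: "normed_space_on V N"
    and NM: "\<And>x. x \<in> V \<Longrightarrow> N x \<le> M x" and MN: "\<And>x. x \<in> V \<Longrightarrow> M x \<le> K * N x" and K: "K > 0"
  shows "banach_space_on V N"
proof -
  interpret M: banach_space_on V M by fact
  interpret N: normed_space_on V N by fact
  have diff: "x - y \<in> V" if "x \<in> V" "y \<in> V" for x y
    using that subspace_diff[OF M.subspace_carrier] by blast
  show ?thesis
  proof
    show N.mcomplete
      unfolding N.mcomplete_def
    proof (intro allI impI)
      fix \<sigma> assume C: "N.MCauchy \<sigma>"
      then have mem: "\<sigma> n \<in> V" for n
        by (auto simp: N.MCauchy_def)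
      have "M.MCauchy \<sigma>"
        unfolding M.MCauchy_def
      proof (intro conjI allI impI)
        fix \<epsilon> :: real assume "\<epsilon> > 0"
        then have "\<epsilon> / K > 0"
          using K by simp
        then obtain n0 where n0: "\<forall>m n. n0 \<le> m \<longrightarrow> n0 \<le> n \<longrightarrow> N (\<sigma> m - \<sigma> n) < \<epsilon> / K"
          using C mem unfolding N.MCauchy_def by (metis N.dist_on_eq)
        have "M (\<sigma> m - \<sigma> n) < \<epsilon>" if "n0 \<le> m" "n0 \<le> n" for m n
        proof -
          have "M (\<sigma> m - \<sigma> n) \<le> K * N (\<sigma> m - \<sigma> n)"
            by (rule MN[OF diff[OF mem mem]])
          also have "\<dots> < K * (\<epsilon> / K)"
            using n0 that K by (intro mult_strict_left_mono) auto
          finally show ?thesis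
            using K by simp
        qed
        then show "\<exists>n0. \<forall>m n. n0 \<le> m \<longrightarrow> n0 \<le> n \<longrightarrow> dist_on V M (\<sigma> m) (\<sigma> n) < \<epsilon>"
          using mem by (auto simp: M.dist_on_eq)
      qed (use mem in auto)
      then obtain x where x: "limitin M.mtopology \<sigma> x sequentially"
        using M.complete unfolding M.mcomplete_def by blast
      then have xV: "x \<in> V"
        by (simp add: M.limitin_metric)
      have "limitin N.mtopology \<sigma> x sequentially"
        using x unfolding M.limitin_iff_norm[OF mem xV] N.limitin_iff_norm[OF mem xV]
        by (meson NM diff mem xV le_less_trans)
      then show "\<exists>x. limitin N.mtopology \<sigma> x sequentially" ..
    qed
  qed
qed


section \<open>Unit vectors and truncations in the tree space\<close>

definition unit_vec :: "bool list \<Rightarrow> bool list \<Rightarrow> real"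
  where "unit_vec t = (\<lambda>s. if s = t then 1 else 0)"

definition truncate :: "bool list set \<Rightarrow> (bool list \<Rightarrow> real) \<Rightarrow> bool list \<Rightarrow> real"
  where "truncate G x = (\<lambda>t. if t \<in> G then x t else 0)"

lemma unit_vec_c00: "unit_vec t \<in> c00"
  by (simp add: unit_vec_def c00_def)

lemma unit_vec_X_T: "unit_vec t \<in> X_T"
  using unit_vec_c00 c00_subset_X_T by blast

lemma truncate_c00: "finite G \<Longrightarrow> truncate G x \<in> c00"
  by (auto simp: truncate_def c00_def elim: rev_finite_subset)

lemma truncate_X_T: "finite G \<Longrightarrow> truncate G x \<in> X_T"
  using truncate_c00 c00_subset_X_T by blast

lemma sum_unit_vec:
  assumes "finite G"
  shows "(\<Sum>t\<in>G. x t *\<^sub>R unit_vec t) = truncate G x"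
  using assms by (auto simp: fun_eq_iff sum_fun_apply unit_vec_def truncate_def if_distrib
      cong: if_cong)

lemma tree_norm_mono:
  assumes "x \<in> X_T" "y \<in> X_T" "\<And>t. \<bar>x t\<bar> \<le> \<bar>y t\<bar>"
  shows "tree_norm x \<le> tree_norm y"
proof -
  have "(\<Sum>t\<in>F. \<bar>x t\<bar>) \<le> tree_norm y" if "A \<in> tree_chains" "finite F" "F \<subseteq> A" for A F
  proof -
    have "(\<Sum>t\<in>F. \<bar>x t\<bar>) \<le> (\<Sum>t\<in>F. \<bar>y t\<bar>)"
      by (intro sum_mono assms)
    also have "\<dots> \<le> tree_norm y"
      using that tree_norm_le_iff[OF assms(2) tree_norm_nonneg] by blast
    finally show ?thesis .
  qed
  then show ?thesis
    by (subst tree_norm_le_iff[OF assms(1) tree_norm_nonneg]) blast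
qed

text \<open>Outside the support of an approximant \<open>y\<close> of \<open>x\<close>, the vectors \<open>x\<close> and \<open>x - y\<close> agree, so a
  truncation to a set containing that support errs by at most the norm of \<open>x - y\<close>.\<close>

lemma truncate_approx:
  assumes x: "x \<in> X_T" and e: "\<epsilon> > 0"
  obtains G where "finite G"
    "\<And>H. finite H \<Longrightarrow> G \<subseteq> H \<Longrightarrow> tree_norm (truncate H x - x) < \<epsilon>"
proof -
  obtain y where y: "y \<in> c00" "tree_enorm (x - y) < ennreal \<epsilon>"
    using x e unfolding X_T_def by blast
  have yX: "y \<in> X_T"
    using y c00_subset_X_T by blast
  have xy: "x - y \<in> X_T"
    using subspace_diff[OF subspace_X_T x yX] .
  have lt: "tree_norm (x - y) < \<epsilon>"
    using y(2) tree_enorm_X_T[OF xy] by (simp add: ennreal_less_iff tree_norm_nonneg)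
  show ?thesis
  proof (rule that)
    show "finite {t. y t \<noteq> 0}"
      using y(1) by (simp add: c00_def)
    fix H assume H: "finite H" "{t. y t \<noteq> 0} \<subseteq> H"
    have "tree_norm (truncate H x - x) \<le> tree_norm (x - y)"
    proof (rule tree_norm_mono[OF subspace_diff[OF subspace_X_T truncate_X_T[OF H(1)] x] xy])
      fix t show "\<bar>(truncate H x - x) t\<bar> \<le> \<bar>(x - y) t\<bar>"
      proof (cases "t \<in> H")
        case False
        then have "y t = 0"
          using H(2) by blast
        then show ?thesis
          using False by (simp add: truncate_def)
      qed (simp add: truncate_def)
    qed
    then show "tree_norm (truncate H x - x) < \<epsilon>"
      using lt by simp
  qed
qed


section \<open>The norm of signed sums over chains\<close>

text \<open>The empty chain is included so that all subsets of members are members.\<close>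

definition finite_chains :: "bool list set set"
  where "finite_chains = {F. finite F \<and> (\<forall>s\<in>F. \<forall>t\<in>F. prefix s t \<or> prefix t s)}"

definition chain_sum_norm :: "(bool list \<Rightarrow> real) \<Rightarrow> real"
  where "chain_sum_norm x = (SUP F\<in>finite_chains. \<bar>\<Sum>t\<in>F. x t\<bar>)"

lemma finite_chains_subset: "F \<in> finite_chains \<Longrightarrow> E \<subseteq> F \<Longrightarrow> E \<in> finite_chains"
  by (auto simp: finite_chains_def elim: rev_finite_subset)

lemma empty_finite_chain: "{} \<in> finite_chains"
  by (simp add: finite_chains_def)

lemma sum_abs_chain_le_tree_norm:
  assumes "x \<in> X_T" "F \<in> finite_chains"
  shows "(\<Sum>t\<in>F. \<bar>x t\<bar>) \<le> tree_norm x"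
proof (cases "F = {}")
  case False
  then have "F \<in> tree_chains" "finite F"
    using assms(2) by (auto simp: finite_chains_def tree_chains_def)
  then show ?thesis
    using tree_norm_le_iff[OF assms(1) tree_norm_nonneg] by blast
qed (simp add: tree_norm_nonneg)

lemma abs_sum_chain_le_tree_norm:
  assumes "x \<in> X_T" "F \<in> finite_chains"
  shows "\<bar>\<Sum>t\<in>F. x t\<bar> \<le> tree_norm x"
  using sum_abs_chain_le_tree_norm[OF assms] sum_abs[of x F] by linarith

lemma abs_sum_chain_le:
  assumes "x \<in> X_T" "F \<in> finite_chains"
  shows "\<bar>\<Sum>t\<in>F. x t\<bar> \<le> chain_sum_norm x"
  unfolding chain_sum_norm_def
  using assms by (intro cSUP_upper bdd_aboveI2[where M = "tree_norm x"] abs_sum_chain_le_tree_norm)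

lemma chain_sum_norm_le:
  assumes "\<And>F. F \<in> finite_chains \<Longrightarrow> \<bar>\<Sum>t\<in>F. x t\<bar> \<le> c"
  shows "chain_sum_norm x \<le> c"
  unfolding chain_sum_norm_def using assms empty_finite_chain by (intro cSUP_least) auto

lemma chain_sum_norm_nonneg: "x \<in> X_T \<Longrightarrow> 0 \<le> chain_sum_norm x"
  using abs_sum_chain_le[OF _ empty_finite_chain] by simp

lemma chain_sum_norm_le_tree_norm: "x \<in> X_T \<Longrightarrow> chain_sum_norm x \<le> tree_norm x"
  by (intro chain_sum_norm_le abs_sum_chain_le_tree_norm)

text \<open>Subsets of chains are chains, so the positive and the negative entries of \<open>x\<close> on a chain
  can be summed separately.\<close>

lemma tree_norm_le_chain_sum_norm:
  assumes x: "x \<in> X_T"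
  shows "tree_norm x \<le> 2 * chain_sum_norm x"
proof -
  have "(\<Sum>t\<in>F. \<bar>x t\<bar>) \<le> 2 * chain_sum_norm x" if A: "A \<in> tree_chains" "finite F" "F \<subseteq> A" for A F
  proof -
    have F: "F \<in> finite_chains"
      using A by (auto simp: finite_chains_def tree_chains_def)
    define P where "P = {t\<in>F. x t \<ge> 0}"
    have P: "P \<in> finite_chains" "F - P \<in> finite_chains"
      using F by (auto simp: P_def intro: finite_chains_subset)
    have "(\<Sum>t\<in>F. \<bar>x t\<bar>) = (\<Sum>t\<in>F - P. \<bar>x t\<bar>) + (\<Sum>t\<in>P. \<bar>x t\<bar>)"
      using A(2) by (intro sum.subset_diff) (auto simp: P_def)
    also have "(\<Sum>t\<in>P. \<bar>x t\<bar>) = (\<Sum>t\<in>P. x t)"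
      by (intro sum.cong) (auto simp: P_def)
    also have "(\<Sum>t\<in>F - P. \<bar>x t\<bar>) = (\<Sum>t\<in>F - P. - x t)"
      by (intro sum.cong) (auto simp: P_def)
    also have "(\<Sum>t\<in>F - P. - x t) + (\<Sum>t\<in>P. x t) = (\<Sum>t\<in>P. x t) - (\<Sum>t\<in>F - P. x t)"
      by (simp add: sum_negf)
    also have "\<dots> \<le> 2 * chain_sum_norm x"
      using abs_sum_chain_le[OF x P(1)] abs_sum_chain_le[OF x P(2)] by linarith
    finally show ?thesis .
  qed
  then show ?thesis
    using chain_sum_norm_nonneg[OF x] by (subst tree_norm_le_iff[OF x]) auto
qed

lemma abs_le_chain_sum_norm:
  assumes "x \<in> X_T"
  shows "\<bar>x t\<bar> \<le> chain_sum_norm x"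
  using abs_sum_chain_le[OF assms, of "{t}"] by (simp add: finite_chains_def)

lemma chain_sum_norm_truncate_le:
  assumes "x \<in> X_T"
  shows "chain_sum_norm (truncate G x) \<le> chain_sum_norm x"
proof (rule chain_sum_norm_le)
  fix F assume F: "F \<in> finite_chains"
  then have "(\<Sum>t\<in>F. truncate G x t) = (\<Sum>t\<in>F \<inter> G. x t)"
    unfolding truncate_def by (intro sum.inter_restrict[symmetric]) (simp add: finite_chains_def)
  then show "\<bar>\<Sum>t\<in>F. truncate G x t\<bar> \<le> chain_sum_norm x"
    using abs_sum_chain_le[OF assms finite_chains_subset[OF F, of "F \<inter> G"]] by simp
qed

lemma normed_chain_sum: "normed_space_on X_T chain_sum_norm"
proof
  show "subspace X_T" by (rule subspace_X_T)
next
  fix x assume x: "x \<in> X_T"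
  show "0 \<le> chain_sum_norm x" by (rule chain_sum_norm_nonneg[OF x])
  show "chain_sum_norm x = 0 \<longleftrightarrow> x = 0"
  proof
    assume "chain_sum_norm x = 0"
    then show "x = 0"
      using abs_le_chain_sum_norm[OF x] by (auto simp: fun_eq_iff)
  next
    assume "x = 0"
    then show "chain_sum_norm x = 0"
      using chain_sum_norm_le[of x 0] chain_sum_norm_nonneg[OF x] by simp
  qed
  fix r
  have eq: "\<bar>\<Sum>t\<in>F. (r *\<^sub>R x) t\<bar> = \<bar>r\<bar> * \<bar>\<Sum>t\<in>F. x t\<bar>" for F
    by (simp add: sum_distrib_left[symmetric] abs_mult)
  show "chain_sum_norm (r *\<^sub>R x) = \<bar>r\<bar> * chain_sum_norm x"
  proof (rule antisym)
    show "chain_sum_norm (r *\<^sub>R x) \<le> \<bar>r\<bar> * chain_sum_norm x"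
      unfolding eq by (rule chain_sum_norm_le, unfold eq)
        (intro mult_left_mono abs_sum_chain_le x, auto)
    show "\<bar>r\<bar> * chain_sum_norm x \<le> chain_sum_norm (r *\<^sub>R x)"
    proof (cases "r = 0")
      case True
      then show ?thesis
        using chain_sum_norm_nonneg[OF subspace_scale[OF subspace_X_T x, of r]] by simp
    next
      case False
      have "chain_sum_norm x \<le> chain_sum_norm (r *\<^sub>R x) / \<bar>r\<bar>"
      proof (rule chain_sum_norm_le)
        fix F assume "F \<in> finite_chains"
        from abs_sum_chain_le[OF subspace_scale[OF subspace_X_T x, of r] this]
        show "\<bar>\<Sum>t\<in>F. x t\<bar> \<le> chain_sum_norm (r *\<^sub>R x) / \<bar>r\<bar>"
          using False unfolding eq by (simp add: field_simps)
      qed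
      then show ?thesis
        using False by (simp add: field_simps)
    qed
  qed
next
  fix x y assume xy: "x \<in> X_T" "y \<in> X_T"
  show "chain_sum_norm (x + y) \<le> chain_sum_norm x + chain_sum_norm y"
  proof (rule chain_sum_norm_le)
    fix F assume F: "F \<in> finite_chains"
    show "\<bar>\<Sum>t\<in>F. (x + y) t\<bar> \<le> chain_sum_norm x + chain_sum_norm y"
      using abs_sum_chain_le[OF xy(1) F] abs_sum_chain_le[OF xy(2) F]
      by (simp add: sum.distrib)
  qed
qed

interpretation CS: normed_space_on X_T chain_sum_norm
  by (rule normed_chain_sum)

lemma banach_chain_sum: "banach_space_on X_T chain_sum_norm"
  by (rule banach_space_on_equivalent_norm[OF banach_X_T normed_chain_sum, where K = 2])
    (auto intro: chain_sum_norm_le_tree_norm tree_norm_le_chain_sum_norm)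

lemma isomorphic_chain_sum: "linearly_isomorphic X_T chain_sum_norm X_T tree_norm"
  unfolding linearly_isomorphic_def
proof (intro exI conjI)
  show "bounded_linear_on X_T chain_sum_norm X_T tree_norm (\<lambda>x. x)"
    unfolding bounded_linear_on_def using tree_norm_le_chain_sum_norm by auto
  show "bounded_linear_on X_T tree_norm X_T chain_sum_norm (\<lambda>x. x)"
    unfolding bounded_linear_on_def
    using chain_sum_norm_le_tree_norm by (auto intro!: exI[of _ 1])
qed auto

text \<open>The partial sums of the expansion of \<open>x\<close> are truncations of \<open>x\<close>, hence converge; the
  coefficients are unique because evaluation at a node is continuous.\<close>

lemma schauder_basis_unit_vec:
  assumes w: "bij (w :: nat \<Rightarrow> bool list)"
  shows "schauder_basis X_T chain_sum_norm (\<lambda>n. unit_vec (w n))"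
  unfolding schauder_basis_def
proof (intro conjI ballI)
  show "range (\<lambda>n. unit_vec (w n)) \<subseteq> X_T"
    using unit_vec_X_T by blast
next
  fix x assume x: "x \<in> X_T"
  have inj: "inj_on w A" for A
    using w by (meson bij_is_inj inj_on_subset subset_UNIV)
  have partial: "(\<Sum>k<n. a k *\<^sub>R unit_vec (w k)) = truncate (w ` {..<n}) (\<lambda>t. a (inv w t))" for a n
  proof -
    have "(\<Sum>k<n. a k *\<^sub>R unit_vec (w k)) = (\<Sum>k<n. a (inv w (w k)) *\<^sub>R unit_vec (w k))"
      using bij_is_inj[OF w] by simp
    also have "\<dots> = (\<Sum>t\<in>w ` {..<n}. a (inv w t) *\<^sub>R unit_vec t)"
      by (simp add: sum.reindex[OF inj])
    finally show ?thesis
      by (simp add: sum_unit_vec)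
  qed
  show "\<exists>!a. limitin CS.mtopology (\<lambda>n. \<Sum>k<n. a k *\<^sub>R unit_vec (w k)) x sequentially"
    unfolding partial CS.limitin_iff_norm[OF truncate_X_T[OF finite_imageI[OF finite_lessThan]] x]
  proof (rule ex1I[of _ "x \<circ> w"], intro allI impI)
    fix \<epsilon> :: real assume "\<epsilon> > 0"
    then obtain G where G: "finite G"
      "\<And>H. finite H \<Longrightarrow> G \<subseteq> H \<Longrightarrow> tree_norm (truncate H x - x) < \<epsilon>"
      using truncate_approx[OF x] by blast
    obtain n0 where n0: "\<forall>k\<in>inv w ` G. k < n0"
      using G(1) finite_nat_set_iff_bounded by blast
    have "chain_sum_norm (truncate (w ` {..<n}) (\<lambda>t. (x \<circ> w) (inv w t)) - x) < \<epsilon>"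
      if "n \<ge> n0" for n
    proof -
      have "(\<lambda>t. (x \<circ> w) (inv w t)) = x"
        using w by (simp add: fun_eq_iff bij_is_surj surj_f_inv_f)
      moreover have "G \<subseteq> w ` {..<n}"
      proof
        fix t assume "t \<in> G"
        then have "inv w t < n"
          using n0 that by force
        then show "t \<in> w ` {..<n}"
          using w by (intro image_eqI[of _ _ "inv w t"]) (auto simp: bij_is_surj surj_f_inv_f)
      qed
      ultimately show ?thesis
        using G(2)[of "w ` {..<n}"] chain_sum_norm_le_tree_norm[OF subspace_diff[OF subspace_X_T
              truncate_X_T[of "w ` {..<n}" x] x]] by simp
    qed
    then show "\<exists>n0. \<forall>n\<ge>n0. chain_sum_norm
        (truncate (w ` {..<n}) (\<lambda>t. (x \<circ> w) (inv w t)) - x) < \<epsilon>"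
      by blast
  next
    fix a assume a: "\<forall>\<epsilon>>0. \<exists>n0. \<forall>n\<ge>n0.
      chain_sum_norm (truncate (w ` {..<n}) (\<lambda>t. a (inv w t)) - x) < \<epsilon>"
    have "a k = x (w k)" for k
    proof (rule ccontr)
      assume "a k \<noteq> x (w k)"
      then have "\<bar>a k - x (w k)\<bar> > 0" by simp
      then obtain n0 where n0: "\<forall>n\<ge>n0.
        chain_sum_norm (truncate (w ` {..<n}) (\<lambda>t. a (inv w t)) - x) < \<bar>a k - x (w k)\<bar>"
        using a by blast
      let ?n = "max n0 (Suc k)"
      have "\<bar>(truncate (w ` {..<?n}) (\<lambda>t. a (inv w t)) - x) (w k)\<bar> < \<bar>a k - x (w k)\<bar>"
        using n0[rule_format, of ?n] abs_le_chain_sum_norm[OF subspace_diff[OF subspace_X_T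
              truncate_X_T[of "w ` {..<?n}" "\<lambda>t. a (inv w t)"] x], of "w k"] by simp
      then show False
        using bij_is_inj[OF w] by (simp add: truncate_def inj_image_mem_iff)
    qed
    then show "a = x \<circ> w"
      by (simp add: fun_eq_iff)
  qed
qed

text \<open>The tree norm ignores signs, so the constant \<open>2\<close> is the one comparing it with
  \<^const>\<open>chain_sum_norm\<close>.\<close>

lemma unconditional_basis_unit_vec:
  assumes w: "bij (w :: nat \<Rightarrow> bool list)"
  shows "unconditional_basis 2 X_T chain_sum_norm (\<lambda>n. unit_vec (w n))"
  unfolding unconditional_basis_def
proof (intro conjI allI impI)
  show "schauder_basis X_T chain_sum_norm (\<lambda>n. unit_vec (w n))"
    by (rule schauder_basis_unit_vec[OF w])
next
  fix a \<theta> :: "nat \<Rightarrow> real"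
  assume *: "finite {n. a n \<noteq> 0} \<and> range \<theta> \<subseteq> {-1, 1}"
  define x where "x = (\<Sum>n | a n \<noteq> 0. a n *\<^sub>R unit_vec (w n))"
  define y where "y = (\<Sum>n | a n \<noteq> 0. (\<theta> n * a n) *\<^sub>R unit_vec (w n))"
  have X: "x \<in> X_T" "y \<in> X_T"
    unfolding x_def y_def
    by (intro subspace_sum[OF subspace_X_T] subspace_scale[OF subspace_X_T] unit_vec_X_T)+
  have coord: "x (w k) = a k" "y (w k) = \<theta> k * a k" for k
    using * bij_is_inj[OF w]
    by (auto simp: x_def y_def sum_fun_apply unit_vec_def inj_eq if_distrib cong: if_cong)
  have "\<bar>y t\<bar> \<le> \<bar>x t\<bar>" for t
  proof -
    obtain k where k: "t = w k"
      using bij_is_surj[OF w] by (metis surjD)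
    have "\<bar>\<theta> k\<bar> = 1"
      using * by (auto dest: subsetD[of _ _ "\<theta> k"])
    then show ?thesis
      by (simp add: k coord abs_mult)
  qed
  then have "tree_norm y \<le> tree_norm x"
    using X by (intro tree_norm_mono)
  then show "chain_sum_norm y \<le> 2 * chain_sum_norm x"
    using chain_sum_norm_le_tree_norm[OF X(2)] tree_norm_le_chain_sum_norm[OF X(1)] by linarith
qed


section \<open>Branches\<close>

definition node :: "(nat \<Rightarrow> bool) \<Rightarrow> nat \<Rightarrow> bool list"
  where "node b n = map b [0..<n]"

lemma length_node [simp]: "length (node b n) = n"
  by (simp add: node_def)

lemma take_node: "k \<le> n \<Longrightarrow> take k (node b n) = node b k"
  by (simp add: node_def take_map)

lemma inj_node: "inj_on (node b) A"
  by (metis inj_onI length_node)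

lemma prefix_node_iff: "prefix s (node b n) \<longleftrightarrow> (\<exists>k\<le>n. s = node b k)"
proof
  assume "prefix s (node b n)"
  then show "\<exists>k\<le>n. s = node b k"
    by (metis append_eq_conv_conj length_node prefix_def prefix_length_le take_node)
next
  assume "\<exists>k\<le>n. s = node b k"
  then show "prefix s (node b n)"
    by (metis take_is_prefix take_node)
qed

lemma node_chain: "node b ` {..<n} \<in> finite_chains"
  unfolding finite_chains_def
  by (auto simp: prefix_node_iff) (metis nat_le_linear)+

lemma chain_same_length:
  assumes "F \<in> finite_chains" "s \<in> F" "t \<in> F" "length s = length t"
  shows "s = t"
proof -
  have "prefix s t \<or> prefix t s"
    using assms by (auto simp: finite_chains_def)
  then show ?thesis
    using assms(4) by (auto simp: prefix_def)
qed

text \<open>A far node of a branch can absorb the whole sum over that branch at no cost in norm. For a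
  chain \<open>F\<close> containing the far node, the sum of \<open>x\<close> over \<open>F\<close> is part of the sum \<open>c\<close> over the
  branch, and subtracting \<open>c\<close> leaves, up to sign, the sum over the complementary part, which is
  itself a chain. For the tree norm this fails: if \<open>x\<close> is the unit vector of the
  root, the shifted vector has tree norm \<open>2\<close>.\<close>

lemma chain_sum_norm_node_shift:
  fixes b :: "nat \<Rightarrow> bool"
  assumes x: "x \<in> X_T" and supp: "\<And>t. x t \<noteq> 0 \<Longrightarrow> length t < n"
  defines "c \<equiv> (\<Sum>k<n. x (node b k))"
  shows "chain_sum_norm (x - c *\<^sub>R unit_vec (node b n)) \<le> chain_sum_norm x"
proof (rule chain_sum_norm_le)
  fix F assume F: "F \<in> finite_chains"
  let ?t = "node b n" and ?P = "node b ` {..<n}"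
  have finF: "finite F"
    using F by (simp add: finite_chains_def)
  have c: "c = (\<Sum>t\<in>?P. x t)"
    unfolding c_def by (simp add: sum.reindex[OF inj_node])
  have sumF: "(\<Sum>s\<in>F. (x - c *\<^sub>R unit_vec ?t) s) = (\<Sum>s\<in>F. x s) - (if ?t \<in> F then c else 0)"
  proof -
    have "(\<Sum>s\<in>F. (x - c *\<^sub>R unit_vec ?t) s) = (\<Sum>s\<in>F. x s - (if s = ?t then c else 0))"
      by (intro sum.cong) (auto simp: unit_vec_def)
    also have "\<dots> = (\<Sum>s\<in>F. x s) - (\<Sum>s\<in>F. if s = ?t then c else 0)"
      by (rule sum_subtractf)
    finally show ?thesis
      using finF by simp
  qed
  show "\<bar>\<Sum>s\<in>F. (x - c *\<^sub>R unit_vec ?t) s\<bar> \<le> chain_sum_norm x"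
  proof (cases "?t \<in> F")
    case False
    then show ?thesis
      unfolding sumF using abs_sum_chain_le[OF x F] by simp
  next
    case True
    have "s \<in> ?P" if s: "s \<in> F" "x s \<noteq> 0" for s
    proof -
      have "prefix s ?t \<or> prefix ?t s"
        using F True s(1) by (auto simp: finite_chains_def)
      then have "prefix s ?t"
        using supp[OF s(2)] prefix_length_le by fastforce
      then show ?thesis
        using supp[OF s(2)] by (auto simp: prefix_node_iff)
    qed
    then have "(\<Sum>s\<in>F. x s) = (\<Sum>s\<in>?P \<inter> F. x s)"
      using finF by (intro sum.mono_neutral_right) auto
    moreover have "c = (\<Sum>s\<in>?P \<inter> F. x s) + (\<Sum>s\<in>?P - F. x s)"
      unfolding c by (subst sum.Int_Diff[of _ _ F]) auto
    ultimately have "(\<Sum>s\<in>F. (x - c *\<^sub>R unit_vec ?t) s) = - (\<Sum>s\<in>?P - F. x s)"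
      unfolding sumF using True by simp
    then show ?thesis
      using abs_sum_chain_le[OF x finite_chains_subset[OF node_chain[of b n], of "?P - F"]] by simp
  qed
qed


section \<open>Functionals are small along most branches\<close>

lemma dual_onD:
  assumes "f \<in> dual_on X_T chain_sum_norm"
  shows "x \<in> X_T \<Longrightarrow> y \<in> X_T \<Longrightarrow> f (x + y) = f x + f y"
    and "x \<in> X_T \<Longrightarrow> f (r *\<^sub>R x) = r * f x"
  using assms by (auto simp: dual_on_def bounded_linear_on_def)

lemma dual_on_diff:
  assumes f: "f \<in> dual_on X_T chain_sum_norm" and "x \<in> X_T" "y \<in> X_T"
  shows "f (x - y) = f x - f y"
  using dual_onD(1)[OF f, of x "(-1) *\<^sub>R y"] dual_onD(2)[OF f, of y "-1"] assms(2,3)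
    subspace_scale[OF subspace_X_T, of y "-1"]
  by simp

lemma dual_on_sum:
  assumes f: "f \<in> dual_on X_T chain_sum_norm" and "finite I" "\<And>i. i \<in> I \<Longrightarrow> z i \<in> X_T"
  shows "f (\<Sum>i\<in>I. r i *\<^sub>R z i) = (\<Sum>i\<in>I. r i * f (z i))"
  using assms(2,3)
proof (induction I rule: finite_induct)
  case empty
  have "f 0 = 0"
    using dual_onD(2)[OF f, of 0 0] subspace_0[OF subspace_X_T] by simp
  then show ?case
    by (simp only: sum.empty)
next
  case (insert i I)
  have X: "r i *\<^sub>R z i \<in> X_T" "(\<Sum>i\<in>I. r i *\<^sub>R z i) \<in> X_T"
    using insert.prems by (auto intro!: subspace_sum[OF subspace_X_T] subspace_scale[OF subspace_X_T])
  have "f (r i *\<^sub>R z i) = r i * f (z i)"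
    using insert.prems by (intro dual_onD(2)[OF f]) auto
  moreover have "f (\<Sum>i\<in>I. r i *\<^sub>R z i) = (\<Sum>i\<in>I. r i * f (z i))"
    by (rule insert.IH) (use insert.prems in auto)
  ultimately show ?case
    unfolding sum.insert[OF insert.hyps] dual_onD(1)[OF f X] by simp
qed

lemma dual_on_bound:
  assumes "f \<in> dual_on X_T chain_sum_norm"
  obtains C where "C > 0" "\<And>x. x \<in> X_T \<Longrightarrow> \<bar>f x\<bar> \<le> C * chain_sum_norm x"
proof -
  have "\<exists>C. \<forall>x\<in>X_T. \<bar>f x\<bar> \<le> C * chain_sum_norm x"
    using assms by (simp add: dual_on_def bounded_linear_on_def)
  then obtain C where C: "\<And>x. x \<in> X_T \<Longrightarrow> \<bar>f x\<bar> \<le> C * chain_sum_norm x"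
    by blast
  have "\<bar>f x\<bar> \<le> max C 1 * chain_sum_norm x" if "x \<in> X_T" for x
    by (rule order.trans[OF C[OF that]])
      (intro mult_right_mono chain_sum_norm_nonneg that, simp)
  then show ?thesis
    using that[of "max C 1"] by simp
qed

text \<open>A chain contains at most one node of each length.\<close>

lemma chain_sum_norm_level_le:
  assumes "finite B" "inj_on (\<lambda>b. node b n) B" "\<And>b. b \<in> B \<Longrightarrow> \<bar>r b\<bar> \<le> 1"
  shows "chain_sum_norm (\<Sum>b\<in>B. r b *\<^sub>R unit_vec (node b n)) \<le> 1"
proof (rule chain_sum_norm_le)
  fix F assume F: "F \<in> finite_chains"
  then have finF: "finite F"
    by (simp add: finite_chains_def)
  have "(\<Sum>t\<in>F. (\<Sum>b\<in>B. r b *\<^sub>R unit_vec (node b n)) t)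
      = (\<Sum>b\<in>B. \<Sum>t\<in>F. r b * unit_vec (node b n) t)"
    by (subst sum.swap) (simp add: sum_fun_apply)
  also have "\<dots> = (\<Sum>b\<in>B. if node b n \<in> F then r b else 0)"
    using finF by (simp add: unit_vec_def if_distrib cong: if_cong)
  also have "\<dots> = (\<Sum>b | b \<in> B \<and> node b n \<in> F. r b)"
    using assms(1) by (simp add: sum.inter_filter)
  also have "\<bar>\<dots>\<bar> \<le> 1"
  proof (cases "\<exists>b\<in>B. node b n \<in> F")
    case True
    then obtain b where b: "b \<in> B" "node b n \<in> F" by blast
    have "b' = b" if "b' \<in> B" "node b' n \<in> F" for b'
      using chain_same_length[OF F that(2) b(2)] assms(2) that(1) b(1) by (auto dest: inj_onD)
    then have "{b'. b' \<in> B \<and> node b' n \<in> F} = {b}"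
      using b by blast
    then show ?thesis
      using assms(3) b by simp
  next
    case False
    then have empty: "{b. b \<in> B \<and> node b n \<in> F} = {}" by blast
    show ?thesis
      unfolding empty by simp
  qed
  finally show "\<bar>\<Sum>t\<in>F. (\<Sum>b\<in>B. r b *\<^sub>R unit_vec (node b n)) t\<bar> \<le> 1" .
qed

lemma eventually_inj_node:
  assumes "finite B"
  shows "\<forall>\<^sub>F n in sequentially. inj_on (\<lambda>b. node b n) B"
proof -
  have "\<forall>\<^sub>F n in sequentially. node b n = node b' n \<longrightarrow> b = b'" for b b'
  proof (cases "b = b'")
    case False
    then obtain k where k: "b k \<noteq> b' k" by blast
    have ne: "node b n \<noteq> node b' n" if "n > k" for n
    proof
      assume "node b n = node b' n"
      then have "node b n ! k = node b' n ! k" by simp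
      then show False
        using k that by (simp add: node_def)
    qed
    then show ?thesis
      using eventually_gt_at_top[of k] by eventually_elim (use ne in blast)
  qed simp
  then show ?thesis
    unfolding inj_on_def using assms by (simp add: eventually_ball_finite)
qed

text \<open>Given \<open>K\<close> such branches, choose a level at which they have split up and at which \<open>f\<close> is large
  on all of them. The signed sum of the \<open>K\<close> unit vectors has norm at most \<open>1\<close>, while \<open>f\<close> takes a
  value of at least \<open>K * \<epsilon>\<close> there, so that \<open>K * \<epsilon>\<close> cannot exceed the norm of \<open>f\<close>.\<close>

lemma finite_branches_bounded_away:
  assumes f: "f \<in> dual_on X_T chain_sum_norm" and e: "\<epsilon> > 0"
  shows "finite {b. \<forall>\<^sub>F n in sequentially. \<epsilon> \<le> \<bar>f (unit_vec (node b n))\<bar>}" (is "finite ?Z")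
proof (rule ccontr)
  assume inf: "infinite ?Z"
  obtain C where C: "C > 0" "\<And>x. x \<in> X_T \<Longrightarrow> \<bar>f x\<bar> \<le> C * chain_sum_norm x"
    using dual_on_bound[OF f] by blast
  obtain K :: nat where K: "C < K * \<epsilon>"
    using reals_Archimedean3[OF e] by blast
  obtain B where B: "B \<subseteq> ?Z" "finite B" "card B = K"
    using infinite_arbitrarily_large[OF inf] by blast
  have "\<forall>\<^sub>F n in sequentially. (\<forall>b\<in>B. \<epsilon> \<le> \<bar>f (unit_vec (node b n))\<bar>)"
    using B by (intro eventually_ball_finite) auto
  then have "\<forall>\<^sub>F n in sequentially.
      (\<forall>b\<in>B. \<epsilon> \<le> \<bar>f (unit_vec (node b n))\<bar>) \<and> inj_on (\<lambda>b. node b n) B"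
    using eventually_inj_node[OF B(2)] by eventually_elim blast
  then obtain n where n: "\<And>b. b \<in> B \<Longrightarrow> \<epsilon> \<le> \<bar>f (unit_vec (node b n))\<bar>"
      "inj_on (\<lambda>b. node b n) B"
    unfolding eventually_sequentially by blast
  define z where "z = (\<Sum>b\<in>B. sgn (f (unit_vec (node b n))) *\<^sub>R unit_vec (node b n))"
  have zX: "z \<in> X_T"
    unfolding z_def
    by (intro subspace_sum[OF subspace_X_T] subspace_scale[OF subspace_X_T] unit_vec_X_T)
  have "chain_sum_norm z \<le> 1"
    unfolding z_def using B(2) n(2) by (intro chain_sum_norm_level_le) (auto simp: sgn_if)
  then have "C * chain_sum_norm z \<le> C * 1"
    using C(1) by (intro mult_left_mono) auto
  then have "f z \<le> C"
    using C(2)[OF zX] by linarith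
  moreover have "f z = (\<Sum>b\<in>B. \<bar>f (unit_vec (node b n))\<bar>)"
    unfolding z_def using dual_on_sum[OF f B(2) unit_vec_X_T]
    by (simp add: abs_sgn mult.commute)
  moreover have "\<dots> \<ge> K * \<epsilon>"
    using sum_bounded_below[of B \<epsilon> "\<lambda>b. \<bar>f (unit_vec (node b n))\<bar>"] n(1) B(3) by simp
  ultimately show False
    using K by linarith
qed

lemma common_good_branch:
  assumes "countable D" "D \<subseteq> dual_on X_T chain_sum_norm"
  obtains b where
    "\<And>f \<epsilon>. f \<in> D \<Longrightarrow> \<epsilon> > 0 \<Longrightarrow> \<exists>\<^sub>F n in sequentially. \<bar>f (unit_vec (node b n))\<bar> < \<epsilon>"
proof -
  define Z where "Z f k =
    {b. \<forall>\<^sub>F n in sequentially. inverse (real (Suc k)) \<le> \<bar>f (unit_vec (node b n))\<bar>}"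
    for f :: "(bool list \<Rightarrow> real) \<Rightarrow> real" and k
  have "countable (Z f k)" if "f \<in> D" for f k
    using assms(2) that unfolding Z_def by (intro countable_finite finite_branches_bounded_away) auto
  then have "countable (\<Union>f\<in>D. \<Union>k. Z f k)"
    by (intro countable_UN assms(1) countableI_type)
  then obtain b where b: "b \<notin> (\<Union>f\<in>D. \<Union>k. Z f k)"
    using uncountable_bool_sequences by (metis UNIV_eq_I)
  have "\<exists>\<^sub>F n in sequentially. \<bar>f (unit_vec (node b n))\<bar> < \<epsilon>" if "f \<in> D" "\<epsilon> > 0" for f \<epsilon>
  proof -
    obtain k where k: "inverse (real (Suc k)) < \<epsilon>"
      using reals_Archimedean[OF \<open>\<epsilon> > 0\<close>] by blast
    have "\<exists>\<^sub>F n in sequentially. \<not> inverse (real (Suc k)) \<le> \<bar>f (unit_vec (node b n))\<bar>"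
      using b \<open>f \<in> D\<close> by (auto simp: Z_def not_eventually)
    then show ?thesis
      by (rule frequently_elim1) (use k in linarith)
  qed
  then show ?thesis
    using that by blast
qed


section \<open>The unit ball is not slicely countably determined\<close>

text \<open>The branch sum is read as a limit of partial sums, so that convex combinations can be formed
  without any summability hypothesis.\<close>

definition null_on_branch :: "(nat \<Rightarrow> bool) \<Rightarrow> (bool list \<Rightarrow> real) set"
  where "null_on_branch b = {x. (\<lambda>m. \<Sum>k<m. x (node b k)) \<longlonglongrightarrow> 0}"

lemma convex_null_on_branch: "convex (null_on_branch b)"
proof (rule convexI)
  fix x y :: "bool list \<Rightarrow> real" and u v :: real
  assume "x \<in> null_on_branch b" "y \<in> null_on_branch b"
  then have "(\<lambda>m. u * (\<Sum>k<m. x (node b k)) + v * (\<Sum>k<m. y (node b k))) \<longlonglongrightarrow> u * 0 + v * 0"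
    unfolding null_on_branch_def by (intro tendsto_intros) auto
  then show "u *\<^sub>R x + v *\<^sub>R y \<in> null_on_branch b"
    by (simp add: null_on_branch_def sum.distrib sum_distrib_left)
qed

lemma unit_vec_root_far_from_null:
  assumes z: "z \<in> null_on_branch b" "z \<in> X_T"
  shows "1 \<le> chain_sum_norm (unit_vec [] - z)"
proof (rule LIMSEQ_le_const2)
  show "(\<lambda>m. 1 - (\<Sum>k<m. z (node b k))) \<longlonglongrightarrow> 1"
    using z tendsto_diff[OF tendsto_const[of "1::real"]] by (fastforce simp: null_on_branch_def)
  have "1 - (\<Sum>k<m. z (node b k)) \<le> chain_sum_norm (unit_vec [] - z)" if "m \<ge> 1" for m
  proof -
    have root: "node b k = [] \<longleftrightarrow> k = 0" for k
      by (simp add: node_def)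
    have "1 - (\<Sum>k<m. z (node b k)) = (\<Sum>k<m. (unit_vec [] - z) (node b k))"
      using that by (simp add: sum_subtractf unit_vec_def root)
    also have "\<dots> = (\<Sum>t\<in>node b ` {..<m}. (unit_vec [] - z) t)"
      by (subst sum.reindex[OF inj_node]) simp
    also have "\<dots> \<le> chain_sum_norm (unit_vec [] - z)"
      using abs_sum_chain_le[OF subspace_diff[OF subspace_X_T unit_vec_X_T z(2)] node_chain,
          of "[]" b m] by linarith
    finally show ?thesis .
  qed
  then show "\<exists>M. \<forall>m\<ge>M. 1 - (\<Sum>k<m. z (node b k)) \<le> chain_sum_norm (unit_vec [] - z)"
    by blast
qed

text \<open>A large truncation \<open>y\<close> of a point of the slice is still in the slice; then the sum of \<open>y\<close> over
  the branch is subtracted at a far node at which \<open>f\<close> is smaller than the room left in the slice.\<close>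

lemma slice_meets_null_on_branch:
  assumes f: "f \<in> dual_on X_T chain_sum_norm"
    and b: "\<And>\<epsilon>. \<epsilon> > 0 \<Longrightarrow> \<exists>\<^sub>F n in sequentially. \<bar>f (unit_vec (node b n))\<bar> < \<epsilon>"
    and ne: "slice (unit_ball X_T chain_sum_norm) f \<delta> \<noteq> {}"
  shows "slice (unit_ball X_T chain_sum_norm) f \<delta> \<inter> null_on_branch b \<noteq> {}"
proof -
  define \<beta> where "\<beta> = (SUP y\<in>unit_ball X_T chain_sum_norm. f y) - \<delta>"
  obtain x where x: "x \<in> X_T" "chain_sum_norm x \<le> 1" "f x > \<beta>"
    using ne by (auto simp: slice_def unit_ball_def \<beta>_def)
  obtain C where C: "C > 0" "\<And>x. x \<in> X_T \<Longrightarrow> \<bar>f x\<bar> \<le> C * chain_sum_norm x"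
    using dual_on_bound[OF f] by blast
  obtain G where G: "finite G" "tree_norm (truncate G x - x) < (f x - \<beta>) / C"
    using truncate_approx[OF x(1), of "(f x - \<beta>) / C"] x(3) C(1) by auto
  define y where "y = truncate G x"
  have y: "y \<in> X_T" "chain_sum_norm y \<le> 1"
    using truncate_X_T[OF G(1)] chain_sum_norm_truncate_le[OF x(1), of G] x(2)
    by (auto simp: y_def)
  have yx: "y - x \<in> X_T"
    using subspace_diff[OF subspace_X_T y(1) x(1)] .
  have "\<bar>f y - f x\<bar> \<le> C * chain_sum_norm (y - x)"
    using C(2)[OF yx] dual_on_diff[OF f y(1) x(1)] by simp
  also have "\<dots> \<le> C * tree_norm (y - x)"
    using C(1) chain_sum_norm_le_tree_norm[OF yx] by simp
  also have "\<dots> < f x - \<beta>"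
    using G(2) C(1) by (simp add: y_def field_simps)
  finally have fy: "f y > \<beta>" by linarith
  obtain n0 where n0: "\<forall>k\<in>length ` G. k < n0"
    using G(1) finite_nat_set_iff_bounded by blast
  obtain n where n: "n \<ge> n0" "\<bar>f (unit_vec (node b n))\<bar> < f y - \<beta>"
    using b[of "f y - \<beta>"] fy by (auto simp: frequently_sequentially)
  have supp: "length t < n" if "y t \<noteq> 0" for t
    using that n0 n(1) by (auto simp: y_def truncate_def split: if_splits)
  define c where "c = (\<Sum>k<n. y (node b k))"
  define z where "z = y - c *\<^sub>R unit_vec (node b n)"
  have eX: "c *\<^sub>R unit_vec (node b n) \<in> X_T"
    by (intro subspace_scale[OF subspace_X_T] unit_vec_X_T)
  have zX: "z \<in> X_T"
    unfolding z_def by (rule subspace_diff[OF subspace_X_T y(1) eX])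
  have z1: "chain_sum_norm z \<le> 1"
    using chain_sum_norm_node_shift[OF y(1) supp, of b] y(2) by (simp add: z_def c_def)
  have "\<bar>c\<bar> \<le> 1"
    using abs_sum_chain_le[OF y(1) node_chain, of b n] y(2)
    by (simp add: c_def sum.reindex[OF inj_node])
  then have "\<bar>c * f (unit_vec (node b n))\<bar> \<le> \<bar>f (unit_vec (node b n))\<bar>"
    by (simp add: abs_mult mult_left_le_one_le)
  moreover have "f z = f y - c * f (unit_vec (node b n))"
    unfolding z_def by (simp add: dual_on_diff[OF f y(1) eX] dual_onD(2)[OF f unit_vec_X_T])
  ultimately have "f z > \<beta>"
    using n(2) by linarith
  then have "z \<in> slice (unit_ball X_T chain_sum_norm) f \<delta>"
    using zX z1 by (simp add: slice_def unit_ball_def \<beta>_def)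
  moreover have "z \<in> null_on_branch b"
  proof -
    have "(\<Sum>k<m. z (node b k)) = 0" if "m > n" for m
    proof -
      have y0: "y (node b k) = 0" if "k \<ge> n" for k
        using supp[of "node b k"] that by auto
      have "(\<Sum>k<m. y (node b k)) = c"
        unfolding c_def using that y0 by (intro sum.mono_neutral_right) auto
      moreover have "z (node b k) = y (node b k) - (if k = n then c else 0)" for k
        by (auto simp: z_def unit_vec_def dest: arg_cong[of _ _ length])
      ultimately show ?thesis
        using that by (simp add: sum_subtractf)
    qed
    then have "\<forall>\<^sub>F m in sequentially. (\<Sum>k<m. z (node b k)) = 0"
      by (rule eventually_mono[OF eventually_gt_at_top[of n]])
    then show ?thesis
      unfolding null_on_branch_def by (simp add: tendsto_eventually)
  qed
  ultimately show ?thesis by blast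
qed

theorem not_SCD_chain_sum_ball: "\<not> SCD X_T chain_sum_norm (unit_ball X_T chain_sum_norm)"
proof
  let ?B = "unit_ball X_T chain_sum_norm"
  assume "SCD X_T chain_sum_norm ?B"
  then obtain I :: "nat set" and S where
    sl: "\<forall>i\<in>I. \<exists>f\<in>dual_on X_T chain_sum_norm. \<exists>\<delta>>0. S i = slice ?B f \<delta>" and
    det: "determining X_T chain_sum_norm ?B I S"
    unfolding SCD_def by auto
  have ne: "S i \<noteq> {}" "S i \<subseteq> ?B" if "i \<in> I" for i
    using det that by (auto simp: determining_def)
  obtain f \<delta> where f: "\<And>i. i \<in> I \<Longrightarrow> f i \<in> dual_on X_T chain_sum_norm \<and> S i = slice ?B (f i) (\<delta> i)"
    using sl by metis
  obtain b where b: "\<And>g \<epsilon>. g \<in> f ` I \<Longrightarrow> \<epsilon> > 0 \<Longrightarrow>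
      \<exists>\<^sub>F n in sequentially. \<bar>g (unit_vec (node b n))\<bar> < \<epsilon>"
    using common_good_branch[of "f ` I"] f by auto
  have "\<exists>z. z \<in> S i \<and> z \<in> null_on_branch b" if "i \<in> I" for i
    using slice_meets_null_on_branch[of "f i" b "\<delta> i"] f[OF that] b[of "f i"] ne(1)[OF that] that
    by blast
  then obtain x where x: "\<And>i. i \<in> I \<Longrightarrow> x i \<in> S i \<and> x i \<in> null_on_branch b"
    by metis
  have hull: "convex hull (x ` I) \<subseteq> null_on_branch b \<inter> X_T"
    using x ne(2)
    by (intro hull_minimal convex_Int convex_null_on_branch subspace_imp_convex subspace_X_T)
      (auto simp: unit_ball_def)
  have "chain_sum_norm (unit_vec []) \<le> 1"
    using chain_sum_norm_level_le[of "{\<lambda>_. True}" 0 "\<lambda>_. 1"] by (simp add: node_def)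
  then have "unit_vec [] \<in> ?B"
    by (simp add: unit_ball_def unit_vec_X_T)
  moreover have "x \<in> Pi I S"
    using x by blast
  ultimately have "unit_vec [] \<in> CS.mtopology closure_of (convex hull (x ` I))"
    using det unfolding determining_def by (metis subsetD)
  then obtain z where z: "z \<in> convex hull (x ` I)" "dist_on X_T chain_sum_norm (unit_vec []) z < 1"
    unfolding CS.metric_closure_of by (auto dest: spec[of _ 1])
  then have "z \<in> null_on_branch b" "z \<in> X_T"
    using hull by auto
  with z(2) show False
    using unit_vec_root_far_from_null[of z b] by (simp add: CS.dist_on_eq unit_vec_X_T)
qed

theorem theorem1p4:
  shows "\<exists>(Y :: (bool list \<Rightarrow> real) set) N u.
    banach_space_on Y N \<and>
    linearly_isomorphic Y N X_T tree_norm \<and>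
    unconditional_basis 2 Y N u \<and>
    \<not> SCD Y N (unit_ball Y N)"
proof -
  have "bij (from_nat_into (UNIV :: bool list set))"
    by (intro bij_betw_from_nat_into countableI_type infinite_UNIV_listI)
  then show ?thesis
    using banach_chain_sum isomorphic_chain_sum unconditional_basis_unit_vec
      not_SCD_chain_sum_ball by blast
qed

end
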